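(* Let $\mu$ be a Borel probability measure on $\mathbb{R}$ with mean zero, and let $0<\alpha\le\beta<\infty$ and $L>0$ be such that: (i) $\mathrm{Supp}(\mu)$ is an interval contained in $[-L,L]$; (ii) $\mu$ is absolutely continuous with respect to Lebesgue measure and $\alpha\le\frac{\mu(dx)}{dx}\le\beta$ for all $x\in\mathrm{Supp}(\mu)$. Let $T_\mu$ be the stopping time defined in the context. Then $$T_\mu\le 2L^2\,\frac{\beta}{\alpha}$$ almost surely.
   Context: $\mathrm{Supp}(\mu)$ is the minimal closed set of full $\mu$-measure. Definition of $T_\mu$. Let $\mu$ be a Borel probability measure on $\mathbb{R}$ with mean zero and finite second moment. For $b\ge 0$, $c\in\mathbb{R}$ set (whenever the integrals converge; in particular for $b>0$ and for $(b,c)=(0,0)$) $$V_\mu(b,c)=\int_{\mathbb{R}} e^{cx-\frac12 bx^2}\mu(dx),\qquad a_\mu(b,c)=V_\mu(b,c)^{-1}\int_{\mathbb{R}} x\,e^{cx-\frac12 bx^2}\mu(dx),$$ $$A_\mu(b,c)=V_\mu(b,c)^{-1}\int_{\mathbb{R}}(x-a_\mu(b,c))^2e^{cx-\frac12 bx^2}\mu(dx).$$ Let $W_t$ be a standard Wiener process and consider the system of stochastic differential equations $$c_0=0,\quad dc_t=A_\mu^{-1}(b_t,c_t)\,dW_t+A_\mu^{-2}(b_t,c_t)\,a_\mu(b_t,c_t)\,dt,\qquad b_0=0,\quad db_t=A_\mu^{-2}(b_t,c_t)\,dt.$$ This system has a unique maximal solution, with $b_t>0$ for $t>0$. $T_\mu$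 is the supremum of the set of times up to which the solution exists ($T_\mu=\infty$ if it exists for all $t\ge 0$); equivalently, almost surely, the solution exists exactly on $[0,T_\mu)$ and $T_\mu=\sup\{t\ge 0:\ A_\mu(b_t,c_t)>0\}$. *)

theory Defs
  imports "HOL-Probability.Probability"
begin

definition Supp :: "real measure \<Rightarrow> real set" where
  "Supp \<mu> = \<Inter>{C. closed C \<and> emeasure \<mu> C = emeasure \<mu> (space \<mu>)}"

definition V_mu :: "real measure \<Rightarrow> real \<Rightarrow> real \<Rightarrow> real" where
  "V_mu \<mu> b c = (\<integral>x. exp (c * x - b * x\<^sup>2 / 2) \<partial>\<mu>)"

definition a_mu :: "real measure \<Rightarrow> real \<Rightarrow> real \<Rightarrow> real" where
  "a_mu \<mu> b c = inverse (V_mu \<mu> b c) * (\<integral>x. x * exp (c * x - b * x\<^sup>2 / 2) \<partial>\<mu>)"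

definition A_mu :: "real measure \<Rightarrow> real \<Rightarrow> real \<Rightarrow> real" where
  "A_mu \<mu> b c = inverse (V_mu \<mu> b c) *
     (\<integral>x. (x - a_mu \<mu> b c)\<^sup>2 * exp (c * x - b * x\<^sup>2 / 2) \<partial>\<mu>)"


text \<open>
  Filtrations are indexed by \<open>ennreal\<close>, that is by $[0,\infty]$, so that the library notion
  \<^const>\<open>stopping_time\<close> covers stopping times which may be infinite.  The \<open>\<sigma>\<close>-algebra with index
  \<open>\<infinity>\<close> is any sub-\<open>\<sigma>\<close>-algebra containing the others.  Processes are functions
  \<open>X :: real \<Rightarrow> 'w \<Rightarrow> real\<close> of which only the values at times \<open>t \<ge> 0\<close> matter.
  Neither completeness nor right-continuity of the filtration is required.
\<close>

definition filtered_prob_space :: "'w measure \<Rightarrow> (ennreal \<Rightarrow> 'w measure) \<Rightarrow> bool" where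
  "filtered_prob_space M F \<longleftrightarrow>
     prob_space M \<and> filtration (space M) F \<and> (\<forall>t. subalgebra M (F t))"

definition adapted :: "(ennreal \<Rightarrow> 'w measure) \<Rightarrow> (real \<Rightarrow> 'w \<Rightarrow> real) \<Rightarrow> bool" where
  "adapted F X \<longleftrightarrow> (\<forall>t\<ge>0. X t \<in> borel_measurable (F (ennreal t)))"

definition progressive :: "(ennreal \<Rightarrow> 'w measure) \<Rightarrow> (real \<Rightarrow> 'w \<Rightarrow> real) \<Rightarrow> bool" where
  "progressive F X \<longleftrightarrow> (\<forall>t\<ge>0.
     (\<lambda>(s, \<omega>). X s \<omega>) \<in> borel_measurable (restrict_space borel {0..t} \<Otimes>\<^sub>M F (ennreal t)))"

definition wiener_process ::
  "'w measure \<Rightarrow> (ennreal \<Rightarrow> 'w measure) \<Rightarrow> (real \<Rightarrow> 'w \<Rightarrow> real) \<Rightarrow> bool" where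
  "wiener_process M F W \<longleftrightarrow>
     adapted F W \<and>
     (AE \<omega> in M. W 0 \<omega> = 0) \<and>
     (AE \<omega> in M. continuous_on {0..} (\<lambda>t. W t \<omega>)) \<and>
     (\<forall>s t. 0 \<le> s \<and> s < t \<longrightarrow>
        distributed M lborel (\<lambda>\<omega>. W t \<omega> - W s \<omega>) (normal_density 0 (sqrt (t - s))) \<and>
        prob_space.indep_set M (sets (F (ennreal s)))
          (sets (vimage_algebra (space M) (\<lambda>\<omega>. W t \<omega> - W s \<omega>) borel)))"


text \<open>
  The Ito integral.  A simple integrand is \<open>\<Sum>i<n. \<xi> i * indicator {p i<..p (Suc i)}\<close> with
  \<open>\<xi> i\<close> bounded and measurable at time \<open>p i\<close>.  A process \<open>I\<close> is the integral of a progressively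
  measurable \<open>H\<close> with locally square-integrable paths if it is path-continuous and, for some
  simple integrands $H^k$ and every \<open>u \<ge> 0\<close>, both $\int_0^u (H^k_s - H_s)^2 ds \to 0$ and
  $\int_0^u H^k_s dW_s \to I_u$ in probability.
\<close>

definition simple_integrand ::
  "(ennreal \<Rightarrow> 'w measure) \<Rightarrow> nat \<Rightarrow> (nat \<Rightarrow> real) \<Rightarrow> (nat \<Rightarrow> 'w \<Rightarrow> real) \<Rightarrow> bool" where
  "simple_integrand F n p \<xi> \<longleftrightarrow>
     0 \<le> p 0 \<and> mono p \<and>
     (\<forall>i<n. \<xi> i \<in> borel_measurable (F (ennreal (p i))) \<and>
            bounded (\<xi> i ` space (F (ennreal (p i)))))"

definition simple_process ::
  "nat \<Rightarrow> (nat \<Rightarrow> real) \<Rightarrow> (nat \<Rightarrow> 'w \<Rightarrow> real) \<Rightarrow> real \<Rightarrow> 'w \<Rightarrow> real" where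
  "simple_process n p \<xi> s \<omega> = (\<Sum>i<n. \<xi> i \<omega> * indicator {p i<..p (Suc i)} s)"

definition simple_ito_integral ::
  "(real \<Rightarrow> 'w \<Rightarrow> real) \<Rightarrow> nat \<Rightarrow> (nat \<Rightarrow> real) \<Rightarrow> (nat \<Rightarrow> 'w \<Rightarrow> real) \<Rightarrow> real \<Rightarrow> 'w \<Rightarrow> real" where
  "simple_ito_integral W n p \<xi> u \<omega> =
     (\<Sum>i<n. \<xi> i \<omega> * (W (min (p (Suc i)) u) \<omega> - W (min (p i) u) \<omega>))"

definition has_ito_integral ::
  "'w measure \<Rightarrow> (ennreal \<Rightarrow> 'w measure) \<Rightarrow> (real \<Rightarrow> 'w \<Rightarrow> real) \<Rightarrow>
   (real \<Rightarrow> 'w \<Rightarrow> real) \<Rightarrow> (real \<Rightarrow> 'w \<Rightarrow> real) \<Rightarrow> bool" where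
  "has_ito_integral M F W H I \<longleftrightarrow>
     progressive F H \<and>
     (AE \<omega> in M. \<forall>u\<ge>0. (\<integral>\<^sup>+s\<in>{0..u}. ennreal ((H s \<omega>)\<^sup>2) \<partial>lborel) < \<infinity>) \<and>
     (\<forall>u\<ge>0. I u \<in> borel_measurable M) \<and>
     (AE \<omega> in M. continuous_on {0..} (\<lambda>u. I u \<omega>)) \<and>
     (\<exists>n p \<xi>. (\<forall>k. simple_integrand F (n k) (p k) (\<xi> k)) \<and>
       (\<forall>u\<ge>0. \<forall>\<epsilon>>0.
         (\<lambda>k. measure M {\<omega> \<in> space M. ennreal \<epsilon> <
            (\<integral>\<^sup>+s\<in>{0..u}. ennreal ((simple_process (n k) (p k) (\<xi> k) s \<omega> - H s \<omega>)\<^sup>2) \<partial>lborel)})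
           \<longlonglongrightarrow> 0 \<and>
         (\<lambda>k. measure M {\<omega> \<in> space M. \<epsilon> <
            \<bar>simple_ito_integral W (n k) (p k) (\<xi> k) u \<omega> - I u \<omega>\<bar>})
           \<longlonglongrightarrow> 0))"

text \<open>
  Ito integral on a stochastic interval $[0,T)$, by localisation along stopping times increasing
  to \<open>T\<close>.
\<close>

definition has_local_ito_integral ::
  "'w measure \<Rightarrow> (ennreal \<Rightarrow> 'w measure) \<Rightarrow> (real \<Rightarrow> 'w \<Rightarrow> real) \<Rightarrow> ('w \<Rightarrow> ennreal) \<Rightarrow>
   (real \<Rightarrow> 'w \<Rightarrow> real) \<Rightarrow> (real \<Rightarrow> 'w \<Rightarrow> real) \<Rightarrow> bool" where
  "has_local_ito_integral M F W T H I \<longleftrightarrow>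
     (\<exists>\<tau> J. (\<forall>n. stopping_time F (\<tau> n)) \<and>
       (AE \<omega> in M. incseq (\<lambda>n. \<tau> n \<omega>) \<and> (\<lambda>n. \<tau> n \<omega>) \<longlonglongrightarrow> T \<omega>) \<and>
       (\<forall>n. has_ito_integral M F W (\<lambda>s \<omega>. if ennreal s < \<tau> n \<omega> then H s \<omega> else 0) (J n) \<and>
            (AE \<omega> in M. \<forall>t\<ge>0. ennreal t < T \<omega> \<and> ennreal t \<le> \<tau> n \<omega> \<longrightarrow> I t \<omega> = J n t \<omega>)))"


text \<open>
  \<open>(b, c)\<close> solves the system on $[0,T)$.  The values of \<open>b t\<close> and \<open>c t\<close> on \<open>{T \<le> t}\<close> are
  irrelevant, so they may be taken measurable at time \<open>t\<close>.  The condition \<open>A_mu > 0\<close> says that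
  the coefficients are defined; in particular it forces the integrals in \<open>V_mu\<close>, \<open>a_mu\<close> and
  \<open>A_mu\<close> to converge, since divergent ones are 0 by convention.
\<close>

definition solves_system ::
  "'w measure \<Rightarrow> (ennreal \<Rightarrow> 'w measure) \<Rightarrow> (real \<Rightarrow> 'w \<Rightarrow> real) \<Rightarrow> real measure \<Rightarrow>
   (real \<Rightarrow> 'w \<Rightarrow> real) \<Rightarrow> (real \<Rightarrow> 'w \<Rightarrow> real) \<Rightarrow> ('w \<Rightarrow> ennreal) \<Rightarrow> bool" where
  "solves_system M F W \<mu> b c T \<longleftrightarrow>
     stopping_time F T \<and> adapted F b \<and> adapted F c \<and>
     (AE \<omega> in M. continuous_on {t. 0 \<le> t \<and> ennreal t < T \<omega>} (\<lambda>t. b t \<omega>) \<and>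
                continuous_on {t. 0 \<le> t \<and> ennreal t < T \<omega>} (\<lambda>t. c t \<omega>)) \<and>
     (AE \<omega> in M. b 0 \<omega> = 0 \<and> c 0 \<omega> = 0) \<and>
     (AE \<omega> in M. \<forall>t\<ge>0. ennreal t < T \<omega> \<longrightarrow> 0 < A_mu \<mu> (b t \<omega>) (c t \<omega>)) \<and>
     (AE \<omega> in M. \<forall>t\<ge>0. ennreal t < T \<omega> \<longrightarrow>
        set_integrable lborel {0..t} (\<lambda>s. (inverse (A_mu \<mu> (b s \<omega>) (c s \<omega>)))\<^sup>2) \<and>
        b t \<omega> = (LINT s:{0..t}|lborel. (inverse (A_mu \<mu> (b s \<omega>) (c s \<omega>)))\<^sup>2)) \<and>
     (\<exists>I. has_local_ito_integral M F W T (\<lambda>s \<omega>. inverse (A_mu \<mu> (b s \<omega>) (c s \<omega>))) I \<and>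
        (AE \<omega> in M. \<forall>t\<ge>0. ennreal t < T \<omega> \<longrightarrow>
           set_integrable lborel {0..t}
             (\<lambda>s. (inverse (A_mu \<mu> (b s \<omega>) (c s \<omega>)))\<^sup>2 * a_mu \<mu> (b s \<omega>) (c s \<omega>)) \<and>
           c t \<omega> = I t \<omega> +
             (LINT s:{0..t}|lborel.
                (inverse (A_mu \<mu> (b s \<omega>) (c s \<omega>)))\<^sup>2 * a_mu \<mu> (b s \<omega>) (c s \<omega>))))"

text \<open>
  \<open>T\<close> is the lifetime of the maximal solution: it is attained by a solution and almost surely
  dominates the lifetime of every solution driven by the same Wiener process.  This determines
  \<open>T\<close> up to null sets.
\<close>

definition is_T_mu ::
  "'w measure \<Rightarrow> (ennreal \<Rightarrow> 'w measure) \<Rightarrow> (real \<Rightarrow> 'w \<Rightarrow> real) \<Rightarrow> real measure \<Rightarrow>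
   ('w \<Rightarrow> ennreal) \<Rightarrow> bool" where
  "is_T_mu M F W \<mu> T \<longleftrightarrow>
     (\<exists>b c. solves_system M F W \<mu> b c T) \<and>
     (\<forall>b' c' T'. solves_system M F W \<mu> b' c' T' \<longrightarrow> (AE \<omega> in M. T' \<omega> \<le> T \<omega>))"

end

theory Submission
  imports Defs
begin

text \<open>
  The bound holds path by path and the stochastic equation for \<open>c\<close> plays no role.  Put
  \<open>r = \<beta> / \<alpha>\<close>.  The tilted variance satisfies \<open>A \<le> L\<^sup>2\<close>, because the support lies in
  \<open>{-L..L}\<close>, and \<open>A \<le> r / b\<close>, because a Gaussian of variance \<open>1 / b\<close> truncated to an interval has
  variance at most \<open>1 / b\<close> and the density of \<open>\<mu>\<close> distorts integrals by a factor in \<open>{\<alpha>..\<beta>}\<close>.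
  Hence \<open>b' = A\<^sup>-\<^sup>2 \<ge> max (L\<^sup>-\<^sup>4) (b\<^sup>2 / r\<^sup>2)\<close>.  The first bound brings \<open>b\<close> up to \<open>r / L\<^sup>2\<close> by time
  \<open>r L\<^sup>2\<close>, and from there the second one makes it explode within a further time \<open>r L\<^sup>2\<close>.
\<close>

section \<open>Support of a measure and comparison with Lebesgue measure\<close>

lemma closed_Supp: "closed (Supp \<mu>)"
  unfolding Supp_def by (intro closed_Inter) auto

text \<open>\<open>Supp\<close> intersects possibly uncountably many closed sets, so its full
  measure is not immediate. By Lindelof, countably many of their null complements already cover the
  complement of \<open>Supp\<close>.\<close>

lemma AE_in_Supp:
  assumes "finite_measure \<mu>" and [measurable_cong]: "sets \<mu> = sets borel"
  shows "AE x in \<mu>. x \<in> Supp \<mu>"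
proof -
  interpret finite_measure \<mu> by fact
  define \<C> where "\<C> = {C. closed C \<and> emeasure \<mu> C = emeasure \<mu> (space \<mu>)}"
  obtain \<U> where \<U>: "\<U> \<subseteq> uminus ` \<C>" "countable \<U>" "\<Union>\<U> = \<Union>(uminus ` \<C>)"
    by (rule Lindelof[of "uminus ` \<C>"]) (auto simp: \<C>_def open_Compl)
  have null: "U \<in> null_sets \<mu>" if U: "U \<in> \<U>" for U
  proof -
    obtain C where C: "C \<in> \<C>" "U = - C" using U \<U>(1) by auto
    have [measurable]: "C \<in> sets \<mu>" using C(1) assms(2) by (auto simp: \<C>_def)
    have sp: "space \<mu> = UNIV" using sets_eq_imp_space_eq[OF assms(2)] by simp
    have "emeasure \<mu> (space \<mu> - C) = emeasure \<mu> (space \<mu>) - emeasure \<mu> C"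
      by (intro emeasure_compl) auto
    also have "\<dots> = 0" using C(1) by (simp add: \<C>_def)
    finally show ?thesis using C(2) sp by (auto simp: null_sets_def Compl_eq_Diff_UNIV)
  qed
  have "\<Union>\<U> \<in> null_sets \<mu>"
    using null_sets_UN'[OF \<U>(2), of id \<mu>] null by simp
  moreover have "- Supp \<mu> = \<Union>\<U>"
    unfolding \<U>(3) Supp_def \<C>_def by auto
  ultimately show ?thesis
    by (auto intro!: AE_I'[of "\<Union>\<U>"])
qed

lemma integrable_continuous_bounded_support:
  fixes f :: "real \<Rightarrow> real"
  assumes "finite_measure \<mu>" and "sets \<mu> = sets borel"
    and "AE x in \<mu>. x \<in> {p..q}" and "continuous_on UNIV f"
  shows "integrable \<mu> f"
proof -
  interpret finite_measure \<mu> by fact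
  have "bounded (f ` {p..q})"
    using assms(4) by (intro compact_imp_bounded compact_continuous_image)
      (auto intro: continuous_on_subset)
  then obtain B where "\<And>x. x \<in> {p..q} \<Longrightarrow> norm (f x) \<le> B"
    unfolding bounded_iff by blast
  moreover have "f \<in> borel_measurable \<mu>"
    using borel_measurable_continuous_onI[OF assms(4)] assms(2) by (simp cong: measurable_cong_sets)
  ultimately show ?thesis
    using assms(3) by (intro integrable_const_bound[of f B]) auto
qed

text \<open>Lets integrals against \<open>\<mu>\<close> be traded for Lebesgue integrals over
  \<open>{p..q}\<close>. Because \<open>RN_deriv\<close> is \<open>ennreal\<close>-valued, the
  comparison is made between nonnegative integrals and turned back to reals at the end.\<close>

lemma integral_bounds_density:
  fixes h :: "real \<Rightarrow> real"
  assumes "prob_space \<mu>" and "sets \<mu> = sets borel" and "AE x in \<mu>. x \<in> {p..q}"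
    and ac: "absolutely_continuous lborel \<mu>" and "0 < \<alpha>" "0 < \<beta>"
    and dens: "AE x in lborel. x \<in> {p..q} \<longrightarrow>
           ennreal \<alpha> \<le> RN_deriv lborel \<mu> x \<and> RN_deriv lborel \<mu> x \<le> ennreal \<beta>"
    and h: "continuous_on UNIV h" "\<And>x. 0 \<le> h x"
  shows "\<alpha> * integral {p..q} h \<le> (\<integral>x. h x \<partial>\<mu>)" "(\<integral>x. h x \<partial>\<mu>) \<le> \<beta> * integral {p..q} h"
proof -
  interpret prob_space \<mu> by fact
  let ?f = "RN_deriv lborel \<mu>"
  have \<mu>_eq: "density lborel ?f = \<mu>"
    using assms(2) by (intro sigma_finite_measure.density_RN_deriv ac) (auto intro: lborel.sigma_finite_measure_axioms)
  have [measurable]: "h \<in> borel_measurable borel" by (rule borel_measurable_continuous_onI[OF h(1)])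
  have "AE x in density lborel ?f. x \<in> {p..q}" using assms(3) by (simp only: \<mu>_eq)
  \<comment> \<open>Outside \<open>{p..q}\<close> the assumption \<open>dens\<close> says nothing;
    the upper bound needs the density to vanish there.\<close>
  then have out: "AE x in lborel. 0 < ?f x \<longrightarrow> x \<in> {p..q}"
    by (subst (asm) AE_density) auto
  have int: "integrable \<mu> h"
    using assms(2,3) h(1) by (intro integrable_continuous_bounded_support[of \<mu> p q]) unfold_locales
  have \<mu>h: "ennreal (\<integral>x. h x \<partial>\<mu>) = (\<integral>\<^sup>+x. ennreal (h x) \<partial>\<mu>)"
    using nn_integral_eq_integral[OF int] h(2) by simp
  also have "\<dots> = (\<integral>\<^sup>+x. ?f x * ennreal (h x) \<partial>lborel)"
    by (subst \<mu>_eq[symmetric], subst nn_integral_density) auto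
  finally have eq: "ennreal (\<integral>x. h x \<partial>\<mu>) = (\<integral>\<^sup>+x. ?f x * ennreal (h x) \<partial>lborel)" .
  have hi: "(h has_integral integral {p..q} h) {p..q}"
    using h(1) by (intro integrable_integral integrable_continuous_real) (auto intro: continuous_on_subset)
  have nonneg: "0 \<le> integral {p..q} h" using h(2) hi by (intro Henstock_Kurzweil_Integration.integral_nonneg) auto
  have hn: "(\<integral>\<^sup>+x. ennreal (indicator {p..q} x * h x) \<partial>lborel) = ennreal (integral {p..q} h)"
    using nn_integral_has_integral_lebesgue[OF h(2) hi] by (simp add: nn_integral_completion)
  have scaled: "ennreal (k * integral {p..q} h)
      = (\<integral>\<^sup>+x. ennreal k * ennreal (indicator {p..q} x * h x) \<partial>lborel)" if "0 < k" for k
    using that nonneg by (subst nn_integral_cmult) (auto simp: hn ennreal_mult)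
  have "ennreal (\<alpha> * integral {p..q} h) \<le> ennreal (\<integral>x. h x \<partial>\<mu>)"
    unfolding eq scaled[OF \<open>0 < \<alpha>\<close>]
    by (intro nn_integral_mono_AE, use dens in eventually_elim)
      (auto simp: indicator_def intro!: mult_right_mono)
  then show "\<alpha> * integral {p..q} h \<le> (\<integral>x. h x \<partial>\<mu>)"
    using h(2) by (subst (asm) ennreal_le_iff) (auto intro!: Bochner_Integration.integral_nonneg)
  have "ennreal (\<integral>x. h x \<partial>\<mu>) \<le> ennreal (\<beta> * integral {p..q} h)"
    unfolding eq scaled[OF \<open>0 < \<beta>\<close>]
  proof (intro nn_integral_mono_AE, use dens out in eventually_elim)
    case (elim x)
    then show ?case by (cases "?f x = 0") (auto simp: indicator_def zero_less_iff_neq_zero intro!: mult_right_mono)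
  qed
  then show "(\<integral>x. h x \<partial>\<mu>) \<le> \<beta> * integral {p..q} h"
    using nonneg \<open>0 < \<beta>\<close> by (subst (asm) ennreal_le_iff) auto
qed

section \<open>Bounds on the variance of the tilted measure\<close>

text \<open>
  Integrate the derivative of \<open>(x - m) * g x\<close>, where \<open>g\<close> is the weight and \<open>m\<close> its mean:
  the boundary terms have a favourable sign because \<open>p \<le> m \<le> q\<close>.
\<close>

lemma truncated_gaussian_variance_le:
  fixes b c p q :: real
  assumes "p < q"
  obtains m where "b * integral {p..q} (\<lambda>x. (x - m)\<^sup>2 * exp (c * x - b * x\<^sup>2 / 2))
    \<le> integral {p..q} (\<lambda>x. exp (c * x - b * x\<^sup>2 / 2))"
proof -
  define g where "g x = exp (c * x - b * x\<^sup>2 / 2)" for x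
  have cont: "continuous_on S g" for S unfolding g_def by (intro continuous_intros) auto
  have int: "(\<lambda>x. h x * g x) integrable_on {p..q}" if "continuous_on {p..q} h" for h
    by (intro integrable_continuous_real continuous_on_mult that cont)
  have int_g: "g integrable_on {p..q}" by (rule integrable_continuous_real[OF cont])
  have Zpos: "0 < integral {p..q} g"
  proof -
    have "integral {p..q} g \<noteq> 0"
      using integral_eq_0_iff[of p q g] cont assms by (auto simp: g_def)
    moreover have "0 \<le> integral {p..q} g"
      by (intro Henstock_Kurzweil_Integration.integral_nonneg int_g) (auto simp: g_def)
    ultimately show ?thesis by linarith
  qed
  define m where "m = integral {p..q} (\<lambda>x. x * g x) / integral {p..q} g"
  have gpos: "0 < g x" for x by (simp add: g_def)
  have "integral {p..q} (\<lambda>x. p * g x) \<le> integral {p..q} (\<lambda>x. x * g x)"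
    using gpos by (intro integral_le int continuous_intros) (auto intro!: mult_right_mono less_imp_le)
  moreover have "integral {p..q} (\<lambda>x. x * g x) \<le> integral {p..q} (\<lambda>x. q * g x)"
    using gpos by (intro integral_le int continuous_intros) (auto intro!: mult_right_mono less_imp_le)
  ultimately have pm: "p \<le> m" "m \<le> q" using Zpos by (auto simp: m_def field_simps)
  \<comment> \<open>The weight satisfies \<open>g' = (c - b * x) * g\<close>, and
    \<open>c - b * x\<close> is split as \<open>(c - b * m) - b * (x - m)\<close>. The term with
    \<open>c - b * m\<close> integrates to zero by the choice of \<open>m\<close>.\<close>
  have D: "(((\<lambda>x. (x - m) * g x)) has_vector_derivative
      (g x + (c - b * m) * (x * g x - m * g x) - b * ((x - m)\<^sup>2 * g x))) (at x within {p..q})" for x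
    unfolding g_def
    by (auto intro!: derivative_eq_intros simp: has_real_derivative_iff_has_vector_derivative[symmetric])
      (simp add: algebra_simps power2_eq_square)
  have "((\<lambda>x. g x + (c - b * m) * (x * g x - m * g x) - b * ((x - m)\<^sup>2 * g x))
      has_integral ((q - m) * g q - (p - m) * g p)) {p..q}"
    by (rule fundamental_theorem_of_calculus) (use assms D in auto)
  moreover have "((\<lambda>x. g x + (c - b * m) * (x * g x - m * g x) - b * ((x - m)\<^sup>2 * g x))
      has_integral (integral {p..q} g + (c - b * m) * (integral {p..q} (\<lambda>x. x * g x) - m * integral {p..q} g)
        - b * integral {p..q} (\<lambda>x. (x - m)\<^sup>2 * g x))) {p..q}"
    by (intro has_integral_add has_integral_diff has_integral_mult_right integrable_integral
        int int_g continuous_intros)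
  ultimately have "(q - m) * g q - (p - m) * g p = integral {p..q} g
      + (c - b * m) * (integral {p..q} (\<lambda>x. x * g x) - m * integral {p..q} g)
        - b * integral {p..q} (\<lambda>x. (x - m)\<^sup>2 * g x)"
    by (rule has_integral_unique)
  moreover have "integral {p..q} (\<lambda>x. x * g x) - m * integral {p..q} g = 0"
    using Zpos by (simp add: m_def)
  moreover have "0 \<le> (q - m) * g q" "0 \<le> (m - p) * g p"
    using pm by (auto simp: g_def)
  ultimately have "b * integral {p..q} (\<lambda>x. (x - m)\<^sup>2 * g x) \<le> integral {p..q} g"
    by (simp add: algebra_simps)
  then show ?thesis using that unfolding g_def by blast
qed

context
  fixes \<mu> :: "real measure" and p q :: real
  assumes prob: "prob_space \<mu>" and sets: "sets \<mu> = sets borel" and AE_pq: "AE x in \<mu>. x \<in> {p..q}"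
begin

interpretation prob_space \<mu> by (rule prob)

lemma integrable_tilted:
  assumes "continuous_on UNIV h"
  shows "integrable \<mu> (\<lambda>x. h x * exp (c * x - b * x\<^sup>2 / 2) :: real)"
  by (intro integrable_continuous_bounded_support[OF _ sets AE_pq] continuous_intros assms finite_measure_axioms) auto

lemma V_mu_pos: "0 < V_mu \<mu> b c"
proof -
  have "integrable \<mu> (\<lambda>x. exp (c * x - b * x\<^sup>2 / 2))"
    using integrable_tilted[of "\<lambda>_. 1"] by simp
  then show ?thesis
    unfolding V_mu_def using integral_nonneg_eq_0_iff_AE[of \<mu> "\<lambda>x. exp (c * x - b * x\<^sup>2 / 2)"]
    by (simp add: less_le Bochner_Integration.integral_nonneg)
qed

text \<open>The weighted second moment is smallest about the mean: about \<open>m\<close> it exceeds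
  that about \<open>a = a_mu \<mu> b c\<close> by \<open>(a - m)^2 * V_mu \<mu> b c\<close>. Hence a
  variance bound may use any convenient centre \<open>m\<close>.\<close>

lemma A_mu_le_second_moment:
  "A_mu \<mu> b c * V_mu \<mu> b c \<le> (\<integral>x. (x - m)\<^sup>2 * exp (c * x - b * x\<^sup>2 / 2) \<partial>\<mu>)"
proof -
  define g where "g x = exp (c * x - b * x\<^sup>2 / 2)" for x
  define a where "a = a_mu \<mu> b c"
  define V where "V = V_mu \<mu> b c"
  have V: "0 < V" "(\<integral>x. g x \<partial>\<mu>) = V" using V_mu_pos by (auto simp: V_def V_mu_def g_def)
  have xg: "(\<integral>x. x * g x \<partial>\<mu>) = a * V"
    using V(1) by (simp add: a_def a_mu_def g_def V_def)
  have "(\<integral>x. (x - m)\<^sup>2 * g x \<partial>\<mu>)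
      = (\<integral>x. (x - a)\<^sup>2 * g x + (2 * (a - m) * (x * g x) + (m\<^sup>2 - a\<^sup>2) * g x) \<partial>\<mu>)"
    by (intro Bochner_Integration.integral_cong) (auto simp: algebra_simps power2_eq_square)
  also have "\<dots> = (\<integral>x. (x - a)\<^sup>2 * g x \<partial>\<mu>) + (2 * (a - m) * (a * V) + (m\<^sup>2 - a\<^sup>2) * V)"
    using integrable_tilted[of "\<lambda>_. 1" c b] integrable_tilted[of "\<lambda>x. x" c b]
      integrable_tilted[of "\<lambda>x. (x - a)\<^sup>2" c b]
    by (simp add: g_def[symmetric] xg V(2) continuous_intros)
  also have "\<dots> = A_mu \<mu> b c * V + (a - m)\<^sup>2 * V"
    using V(1) by (simp add: A_mu_def g_def a_def V_def field_simps power2_eq_square)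
  finally show ?thesis using V(1) by (simp add: g_def V_def)
qed

lemma A_mu_le_square:
  assumes "{p..q} \<subseteq> {-L..L}"
  shows "A_mu \<mu> b c \<le> L\<^sup>2"
proof -
  \<comment> \<open>The centre 0 is convenient here, as \<open>x^2\<close> is at most
    \<open>L^2\<close> on \<open>{p..q}\<close>.\<close>
  have "A_mu \<mu> b c * V_mu \<mu> b c \<le> (\<integral>x. x\<^sup>2 * exp (c * x - b * x\<^sup>2 / 2) \<partial>\<mu>)"
    using A_mu_le_second_moment[of b c 0] by simp
  also have "\<dots> \<le> (\<integral>x. L\<^sup>2 * exp (c * x - b * x\<^sup>2 / 2) \<partial>\<mu>)"
  proof (intro integral_mono_AE integrable_tilted continuous_intros)
    show "AE x in \<mu>. x\<^sup>2 * exp (c * x - b * x\<^sup>2 / 2) \<le> L\<^sup>2 * exp (c * x - b * x\<^sup>2 / 2)"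
      using AE_pq
    proof eventually_elim
      case (elim x)
      then have "\<bar>x\<bar> \<le> \<bar>L\<bar>" using assms by auto
      then show ?case by (simp add: abs_le_square_iff)
    qed
  qed
  also have "\<dots> = L\<^sup>2 * V_mu \<mu> b c" by (simp add: V_mu_def)
  finally show ?thesis using V_mu_pos by simp
qed

text \<open>Passing to Lebesgue integrals costs a factor \<open>\<beta>\<close> in the second moment
  and a factor \<open>1 / \<alpha>\<close> in the normalisation \<open>V_mu\<close>. The centre
  \<open>m\<close> is the one supplied by \<open>truncated_gaussian_variance_le\<close>, in general
  different from \<open>a_mu\<close>.\<close>

lemma A_mu_le_ratio:
  assumes "p < q" "0 < b" "0 < \<alpha>" "0 < \<beta>" and "absolutely_continuous lborel \<mu>"
    and "AE x in lborel. x \<in> {p..q} \<longrightarrow>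
           ennreal \<alpha> \<le> RN_deriv lborel \<mu> x \<and> RN_deriv lborel \<mu> x \<le> ennreal \<beta>"
  shows "A_mu \<mu> b c \<le> (\<beta> / \<alpha>) / b"
proof -
  define g where "g x = exp (c * x - b * x\<^sup>2 / 2)" for x
  note bounds = integral_bounds_density[OF prob sets AE_pq assms(5,3,4,6)]
  obtain m where m: "b * integral {p..q} (\<lambda>x. (x - m)\<^sup>2 * g x) \<le> integral {p..q} g"
    unfolding g_def using truncated_gaussian_variance_le[OF \<open>p < q\<close>] by blast
  have "A_mu \<mu> b c * V_mu \<mu> b c \<le> (\<integral>x. (x - m)\<^sup>2 * g x \<partial>\<mu>)"
    using A_mu_le_second_moment by (simp add: g_def)
  also have "\<dots> \<le> \<beta> * integral {p..q} (\<lambda>x. (x - m)\<^sup>2 * g x)"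
    by (intro bounds) (auto simp: g_def intro!: continuous_intros)
  also have "\<dots> \<le> \<beta> * (integral {p..q} g / b)"
    using m assms by (intro mult_left_mono) (auto simp: field_simps)
  also have "\<dots> \<le> \<beta> * ((V_mu \<mu> b c / \<alpha>) / b)"
  proof -
    have "\<alpha> * integral {p..q} g \<le> V_mu \<mu> b c"
      unfolding V_mu_def g_def by (intro bounds) (auto intro!: continuous_intros)
    then show ?thesis
      using assms by (intro mult_left_mono divide_right_mono) (auto simp: field_simps)
  qed
  finally have "A_mu \<mu> b c * V_mu \<mu> b c \<le> ((\<beta> / \<alpha>) / b) * V_mu \<mu> b c" by simp
  then show ?thesis using V_mu_pos by (rule mult_right_le_imp_le)
qed

end

section \<open>Shape of the support\<close>

text \<open>A compact interval has the form \<open>{p..q}\<close>. Were it empty or a point, it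
  would be Lebesgue null, hence \<open>\<mu>\<close>-null, although it carries all the mass.\<close>

lemma Supp_eq_Icc:
  assumes "prob_space \<mu>" and "sets \<mu> = sets borel" and "absolutely_continuous lborel \<mu>"
    and "is_interval (Supp \<mu>)" and "bounded (Supp \<mu>)"
  obtains p q where "p < q" "Supp \<mu> = {p..q}"
proof -
  interpret prob_space \<mu> by fact
  have ae: "AE x in \<mu>. x \<in> Supp \<mu>" by (intro AE_in_Supp assms(2)) unfold_locales
  have "compact (Supp \<mu>)" using closed_Supp assms(5) by (simp add: compact_eq_bounded_closed)
  then obtain p q where pq: "Supp \<mu> = {p..q}"
    using connected_compact_interval_1[of "Supp \<mu>"] assms(4) is_interval_connected by metis
  have "p < q"
  proof (rule ccontr)
    assume "\<not> p < q"
    then have "{p..q} = {} \<or> {p..q} = {p}" by auto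
    then have "{p..q} \<in> null_sets lborel" by (auto simp: null_sets_def)
    then have "{p..q} \<in> null_sets \<mu>" using assms(3) by (auto simp: absolutely_continuous_def)
    then have "AE x in \<mu>. x \<notin> {p..q}" by (rule AE_not_in)
    with ae have "AE x in \<mu>. False" by eventually_elim (simp add: pq)
    then show False by simp
  qed
  then show ?thesis using that pq by blast
qed

section \<open>Explosion under a quadratic lower bound on the growth\<close>

text \<open>
  Only continuity of \<open>b\<close> is available, so the comparison is made with the differentiable minorant
  \<open>B t = y + \<integral>\<^bsub>s\<^esub>\<^bsup>t\<^esup> k * (b u)\<^sup>2 du\<close>, for which \<open>1 / B t + k * t\<close> is nonincreasing.
\<close>

lemma quadratic_growth_blowup:
  fixes b :: "real \<Rightarrow> real"
  assumes cont: "continuous_on {s..t} b" and "s \<le> t" "0 < y" "0 \<le> k"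
    and lower: "\<And>u. u \<in> {s..t} \<Longrightarrow> y + integral {s..u} (\<lambda>v. k * (b v)\<^sup>2) \<le> b u"
  shows "k * (t - s) < 1 / y"
proof -
  define B where "B u = y + integral {s..u} (\<lambda>v. k * (b v)\<^sup>2)" for u
  have Bpos: "y \<le> B u" if "u \<in> {s..t}" for u
  proof -
    have "(\<lambda>v. k * (b v)\<^sup>2) integrable_on {s..u}"
      using that by (intro integrable_continuous_real continuous_intros continuous_on_subset[OF cont]) auto
    then have "0 \<le> integral {s..u} (\<lambda>v. k * (b v)\<^sup>2)"
      using \<open>0 \<le> k\<close> by (intro Henstock_Kurzweil_Integration.integral_nonneg) auto
    then show ?thesis by (simp add: B_def)
  qed
  have D: "(B has_real_derivative k * (b u)\<^sup>2) (at u within {s..t})" if "u \<in> {s..t}" for u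
    unfolding B_def has_real_derivative_iff_has_vector_derivative
    using that by (auto intro!: derivative_eq_intros integral_has_vector_derivative continuous_intros cont)
  have "1 / B t + k * t \<le> 1 / B s + k * s"
  proof (rule DERIV_nonpos_imp_decreasing_open[OF \<open>s \<le> t\<close>])
    show "continuous_on {s..t} (\<lambda>u. 1 / B u + k * u)"
    proof (intro continuous_intros)
      show "continuous_on {s..t} B"
        using D by (rule DERIV_continuous_on)
      show "\<forall>u\<in>{s..t}. B u \<noteq> 0"
        using Bpos \<open>0 < y\<close> by (metis not_less)
    qed
    fix u assume u: "s < u" "u < t"
    then have Bu: "y \<le> B u" "B u \<le> b u" using Bpos lower by (auto simp: B_def)
    \<comment> \<open>From \<open>b \<ge> B > 0\<close> follows
      \<open>B' = k * b^2 \<ge> k * B^2\<close>, that is, \<open>(1 / B)' \<le> - k\<close>.\<close>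
    then have "(B u)\<^sup>2 \<le> (b u)\<^sup>2" using \<open>0 < y\<close> by (intro power_mono) auto
    then have "k * (B u)\<^sup>2 \<le> k * (b u)\<^sup>2" using \<open>0 \<le> k\<close> by (rule mult_left_mono)
    then have "- (k * (b u)\<^sup>2) / (B u)\<^sup>2 + k \<le> 0"
      using Bu \<open>0 < y\<close> by (simp add: field_simps)
    moreover have "((\<lambda>u. 1 / B u + k * u) has_real_derivative - (k * (b u)\<^sup>2) / (B u)\<^sup>2 + k) (at u)"
      using D[of u] u Bu \<open>0 < y\<close>
      by (auto intro!: derivative_eq_intros simp: at_within_Icc_at power2_eq_square)
    ultimately show "\<exists>y. ((\<lambda>u. 1 / B u + k * u) has_real_derivative y) (at u) \<and> y \<le> 0"
      by blast
  qed
  \<comment> \<open>Positivity of \<open>1 / B t\<close> makes the conclusion strict, and it is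
    later applied to a case of equality.\<close>
  moreover have "0 < 1 / B t" using Bpos[of t] assms by simp
  ultimately have "k * t < 1 / B s + k * s" by linarith
  then show ?thesis by (simp add: B_def right_diff_distrib)
qed

text \<open>\<open>\<phi>\<close> stands for the squared inverse variance along one path. The bound
  \<open>\<phi>2\<close> is guarded by \<open>0 < b u\<close> because \<open>b\<close> starts at 0;
  it is invoked only on the second half of the interval.\<close>

lemma no_solution_past_bound:
  fixes b \<phi> :: "real \<Rightarrow> real" and r L :: real
  defines "t \<equiv> 2 * L\<^sup>2 * r"
  assumes "0 < L" "0 < r" and cont: "continuous_on {0..t} b"
    and int: "\<phi> integrable_on {0..t}"
    and b: "\<And>u. u \<in> {0..t} \<Longrightarrow> b u = integral {0..u} \<phi>"
    and \<phi>1: "\<And>u. u \<in> {0..t} \<Longrightarrow> (1 / L\<^sup>2)\<^sup>2 \<le> \<phi> u"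
    and \<phi>2: "\<And>u. u \<in> {0..t} \<Longrightarrow> 0 < b u \<Longrightarrow> (b u / r)\<^sup>2 \<le> \<phi> u"
  shows False
proof -
  \<comment> \<open>Integrating the constant bound up to \<open>s\<close> gives
    \<open>b s \<ge> s / L^4 = r / L^2\<close>, the value of \<open>b\<close> at which the lower
    bounds in \<open>\<phi>1\<close> and \<open>\<phi>2\<close> coincide.\<close>
  define s where "s = L\<^sup>2 * r"
  have st: "0 \<le> s" "s \<le> t" using assms by (auto simp: s_def t_def)
  have "integral {0..s} (\<lambda>_. (1 / L\<^sup>2)\<^sup>2) \<le> integral {0..s} \<phi>"
    using st \<phi>1 by (intro integral_le integrable_subinterval_real[OF int]) auto
  then have bs: "r / L\<^sup>2 \<le> b s"
    using st assms(2,3) b[of s] by (simp add: s_def power2_eq_square)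
  have split: "b u = b s + integral {s..u} \<phi>" if "u \<in> {s..t}" for u
    using that st b[of u] b[of s] Henstock_Kurzweil_Integration.integral_combine[of 0 s u \<phi>]
      integrable_subinterval_real[OF int, of 0 u] by simp
  have \<phi>_nonneg: "0 \<le> \<phi> u" if "u \<in> {0..t}" for u
    using \<phi>1[OF that] zero_le_power2[of "1 / L\<^sup>2"] by linarith
  have bpos: "0 < b u" if "u \<in> {s..t}" for u
  proof -
    have "0 \<le> integral {s..u} \<phi>"
      using that st \<phi>_nonneg
      by (intro Henstock_Kurzweil_Integration.integral_nonneg integrable_subinterval_real[OF int]) auto
    moreover have "0 < r / L\<^sup>2" using assms by simp
    ultimately show ?thesis using split[OF that] bs by linarith
  qed
  \<comment> \<open>Since \<open>t - s = L^2 * r\<close>, both sides equal \<open>L^2 / r\<close>,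
    so this strict inequality is already the contradiction.\<close>
  have "(1 / r)\<^sup>2 * (t - s) < 1 / (r / L\<^sup>2)"
  proof (rule quadratic_growth_blowup[where b = b])
    show "continuous_on {s..t} b" using st by (auto intro: continuous_on_subset[OF cont])
    fix u assume u: "u \<in> {s..t}"
    have "integral {s..u} (\<lambda>v. (1 / r)\<^sup>2 * (b v)\<^sup>2) \<le> integral {s..u} \<phi>"
      using u st \<phi>2 bpos
      by (intro integral_le integrable_subinterval_real[OF int] integrable_continuous_real
          continuous_intros continuous_on_subset[OF cont]) (auto simp: power_divide)
    then show "r / L\<^sup>2 + integral {s..u} (\<lambda>v. (1 / r)\<^sup>2 * (b v)\<^sup>2) \<le> b u"
      using split[OF u] bs by linarith
  qed (use st assms in auto)
  then show False
    using assms(2,3) by (simp add: s_def t_def power2_eq_square field_simps)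
qed

section \<open>Application to the paths of the solution\<close>

theorem theorem1p6:
  fixes \<mu> :: "real measure" and \<alpha> \<beta> L :: real
    and M :: "'w measure" and F :: "ennreal \<Rightarrow> 'w measure"
    and W :: "real \<Rightarrow> 'w \<Rightarrow> real" and T :: "'w \<Rightarrow> ennreal"
  assumes "real_distribution \<mu>"
    and "integrable \<mu> (\<lambda>x. x)" and "(\<integral>x. x \<partial>\<mu>) = 0"
    and "0 < \<alpha>" and "\<alpha> \<le> \<beta>" and "0 < L"
    and "is_interval (Supp \<mu>)" and "Supp \<mu> \<subseteq> {-L..L}"
    and "absolutely_continuous lborel \<mu>"
    and "AE x in lborel. x \<in> Supp \<mu> \<longrightarrow>
           ennreal \<alpha> \<le> RN_deriv lborel \<mu> x \<and> RN_deriv lborel \<mu> x \<le> ennreal \<beta>"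
    and "filtered_prob_space M F"
    and "wiener_process M F W"
    and "is_T_mu M F W \<mu> T"
  shows "AE \<omega> in M. T \<omega> \<le> ennreal (2 * L\<^sup>2 * (\<beta> / \<alpha>))"
proof -
  interpret real_distribution \<mu> by fact
  have sets: "sets \<mu> = sets borel" by simp
  obtain p q where pq: "p < q" "Supp \<mu> = {p..q}"
    using assms(7-9) sets prob_space_axioms
    by (elim Supp_eq_Icc[rotated -1]) (auto intro: bounded_subset[OF bounded_closed_interval])
  have ae: "AE x in \<mu>. x \<in> {p..q}"
    using AE_in_Supp[OF finite_measure_axioms sets] by (simp add: pq)
  define r where "r = \<beta> / \<alpha>"
  have r: "0 < r" using assms(4,5) by (simp add: r_def)
  have A1: "A_mu \<mu> b c \<le> L\<^sup>2" for b c
    using assms(8) unfolding pq by (rule A_mu_le_square[OF prob_space_axioms sets ae])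
  have A2: "A_mu \<mu> b c \<le> r / b" if "0 < b" for b c
    unfolding r_def using assms(4,5,9,10) pq that
    by (intro A_mu_le_ratio[OF prob_space_axioms sets ae]) auto
  obtain b c where sol: "solves_system M F W \<mu> b c T"
    using assms(13) by (auto simp: is_T_mu_def)
  have "AE \<omega> in M. continuous_on {t. 0 \<le> t \<and> ennreal t < T \<omega>} (\<lambda>t. b t \<omega>)"
    "AE \<omega> in M. \<forall>t\<ge>0. ennreal t < T \<omega> \<longrightarrow> 0 < A_mu \<mu> (b t \<omega>) (c t \<omega>)"
    "AE \<omega> in M. \<forall>t\<ge>0. ennreal t < T \<omega> \<longrightarrow>
        set_integrable lborel {0..t} (\<lambda>s. (inverse (A_mu \<mu> (b s \<omega>) (c s \<omega>)))\<^sup>2) \<and>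
        b t \<omega> = (LINT s:{0..t}|lborel. (inverse (A_mu \<mu> (b s \<omega>) (c s \<omega>)))\<^sup>2)"
    using sol by (auto simp: solves_system_def)
  then show ?thesis
  proof eventually_elim
    case (elim \<omega>)
    define \<phi> where "\<phi> s = (inverse (A_mu \<mu> (b s \<omega>) (c s \<omega>)))\<^sup>2" for s
    let ?t = "2 * L\<^sup>2 * r"
    show ?case
    proof (rule ccontr)
      assume "\<not> T \<omega> \<le> ennreal (2 * L\<^sup>2 * (\<beta> / \<alpha>))"
      then have "ennreal ?t < T \<omega>" by (simp add: r_def)
      \<comment> \<open>The negated bound is strict, so the whole closed interval, including its
        endpoint \<open>?t\<close>, lies within the lifetime.\<close>
      then have before: "0 \<le> u \<and> ennreal u < T \<omega>" if "u \<in> {0..?t}" for u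
        using that le_less_trans[OF ennreal_leI, of u ?t] by simp
      \<comment> \<open>Upper bounds on the variance become lower bounds on \<open>\<phi>\<close>;
        inversion reverses the order because the variance is positive during the lifetime.\<close>
      have \<phi>_ge: "(inverse B)\<^sup>2 \<le> \<phi> u" if "u \<in> {0..?t}" "A_mu \<mu> (b u \<omega>) (c u \<omega>) \<le> B" for u B
      proof -
        have "0 < A_mu \<mu> (b u \<omega>) (c u \<omega>)" using elim(2) before[OF that(1)] by simp
        with that(2) show ?thesis
          unfolding \<phi>_def by (intro power_mono le_imp_inverse_le) simp_all
      qed
      show False
      proof (rule no_solution_past_bound[OF \<open>0 < L\<close> r])
        show "continuous_on {0..?t} (\<lambda>u. b u \<omega>)"
          using before by (intro continuous_on_subset[OF elim(1)]) auto
        show "\<phi> integrable_on {0..?t}"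
          unfolding \<phi>_def using elim(3) before[of ?t] r
          by (intro set_borel_integral_eq_integral(1)) auto
        fix u assume u: "u \<in> {0..?t}"
        show "b u \<omega> = integral {0..u} \<phi>"
          unfolding \<phi>_def using elim(3) before[OF u] by (simp add: set_borel_integral_eq_integral(2))
        show "(1 / L\<^sup>2)\<^sup>2 \<le> \<phi> u"
          using \<phi>_ge[OF u A1] by (simp add: inverse_eq_divide)
        show "(b u \<omega> / r)\<^sup>2 \<le> \<phi> u" if "0 < b u \<omega>"
          using \<phi>_ge[OF u A2[OF that]] by simp
      qed
    qed
  qed
qed

end
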